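(* We have $$\frac{\pi}{3}=\cfrac{-6}{-5+\cfrac{-75}{62+\cfrac{29645}{278+\cfrac{a_4}{b_4+\cfrac{a_5}{b_5+\ddots}}}}},$$ where the partial denominators and numerators $b_n,a_n$ are given by $$b_n=2(36n^2-72n+31)\quad\text{and}\quad a_n=(2n-1)(2n-5)(6n-11)^2(6n-7)^2\qquad\text{for every } n\ge2$$ (and $a_1=-6$, $b_1=-5$).
   Context: For sequences of numbers $(a_n)_{n\ge1}$ and $(b_n)_{n\ge0}$, the $n$-th convergent $A_n/B_n$ of the (generalized) continued fraction $b_0+\cfrac{a_1}{b_1+\cfrac{a_2}{b_2+\ddots}}$ is its truncation at $a_n/b_n$. The sequences $(A_n)$, $(B_n)$ satisfy $A_n=b_nA_{n-1}+a_nA_{n-2}$ and $B_n=b_nB_{n-1}+a_nB_{n-2}$ for $n\ge1$, with $A_{-1}=1$, $A_0=b_0$, $B_{-1}=0$, $B_0=1$. A number $x$ equals the continued fraction if $\lim_{n\to\infty}A_n/B_n=x$. When no term $b_0$ is written, $b_0=0$. *)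

theory Defs
  imports Complex_Main
begin

text \<open>
  A pair of sequences a, b encodes the continued fraction
  b 0 + a 1 / (b 1 + a 2 / (b 2 + ...)); the entry a 0 is never used.
  The functions below are the numerators and denominators of its convergents. Their
  values at 1 are what the three-term recurrence gives from the values 1 and 0 at -1.
\<close>

fun gcf_num :: "(nat \<Rightarrow> real) \<Rightarrow> (nat \<Rightarrow> real) \<Rightarrow> nat \<Rightarrow> real" where
  "gcf_num a b 0 = b 0"
| "gcf_num a b (Suc 0) = b 1 * b 0 + a 1"
| "gcf_num a b (Suc (Suc n)) =
     b (Suc (Suc n)) * gcf_num a b (Suc n) + a (Suc (Suc n)) * gcf_num a b n"

fun gcf_den :: "(nat \<Rightarrow> real) \<Rightarrow> (nat \<Rightarrow> real) \<Rightarrow> nat \<Rightarrow> real" where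
  "gcf_den a b 0 = 1"
| "gcf_den a b (Suc 0) = b 1"
| "gcf_den a b (Suc (Suc n)) =
     b (Suc (Suc n)) * gcf_den a b (Suc n) + a (Suc (Suc n)) * gcf_den a b n"

text \<open>
  Since division by zero yields 0 in HOL, convergents must be required explicitly to be
  defined from some index on.
\<close>

definition gcf_has_value :: "(nat \<Rightarrow> real) \<Rightarrow> (nat \<Rightarrow> real) \<Rightarrow> real \<Rightarrow> bool" where
  "gcf_has_value a b x \<longleftrightarrow>
     (\<forall>\<^sub>F n in sequentially. gcf_den a b n \<noteq> 0) \<and>
     (\<lambda>n. gcf_num a b n / gcf_den a b n) \<longlonglongrightarrow> x"

text \<open>
  The remaining material confirms that the convergents are the truncations of the continued
  fraction at a n / b n, whenever no denominator occurring in the truncation vanishes.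
\<close>

fun gcf_trunc :: "(nat \<Rightarrow> real) \<Rightarrow> (nat \<Rightarrow> real) \<Rightarrow> nat \<Rightarrow> real" where
  "gcf_trunc a b 0 = b 0"
| "gcf_trunc a b (Suc n) = b 0 + a 1 / gcf_trunc (\<lambda>i. a (Suc i)) (\<lambda>i. b (Suc i)) n"

lemma gcf_num_shift:
  "gcf_num a b (Suc n) =
     b 0 * gcf_num (\<lambda>i. a (Suc i)) (\<lambda>i. b (Suc i)) n
     + a 1 * gcf_den (\<lambda>i. a (Suc i)) (\<lambda>i. b (Suc i)) n"
  by (induction a b n rule: gcf_num.induct) (simp_all add: algebra_simps)

lemma gcf_den_shift:
  "gcf_den a b (Suc n) = gcf_num (\<lambda>i. a (Suc i)) (\<lambda>i. b (Suc i)) n"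
  by (induction a b n rule: gcf_num.induct) (simp_all add: algebra_simps)

lemma gcf_trunc_eq_convergent:
  assumes "\<And>k. 1 \<le> k \<Longrightarrow> k \<le> n \<Longrightarrow>
    gcf_trunc (\<lambda>i. a (i + k)) (\<lambda>i. b (i + k)) (n - k) \<noteq> 0"
  shows "gcf_den a b n \<noteq> 0 \<and> gcf_trunc a b n = gcf_num a b n / gcf_den a b n"
  using assms
proof (induction n arbitrary: a b)
  case 0
  show ?case by simp
next
  case (Suc n)
  let ?a = "\<lambda>i. a (Suc i)" and ?b = "\<lambda>i. b (Suc i)"
  have IH: "gcf_den ?a ?b n \<noteq> 0 \<and> gcf_trunc ?a ?b n = gcf_num ?a ?b n / gcf_den ?a ?b n"
  proof (rule Suc.IH)
    fix k assume "1 \<le> k" "k \<le> n"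
    then show "gcf_trunc (\<lambda>i. ?a (i + k)) (\<lambda>i. ?b (i + k)) (n - k) \<noteq> 0"
      using Suc.prems[of "Suc k"] by simp
  qed
  have "gcf_trunc ?a ?b n \<noteq> 0"
    using Suc.prems[of 1] by simp
  with IH have "gcf_num ?a ?b n \<noteq> 0" by auto
  with IH show ?case
    by (simp add: gcf_num_shift gcf_den_shift field_simps)
qed

end

theory Submission
  imports Defs
begin

text \<open>
  The continued fraction is Euler's transcription of a series. Its denominators are the
  products \<open>B\<^sub>n = \<Prod>k=1..n. (2k - 3)(6k - 5)(6k - 1)\<close>, and consecutive convergents differ by
  \<open>(-1)^(n-1) (1/(6n - 5) + 1/(6n - 1))\<close>, so its value is the sum of the series
  \<open>1 + 1/5 - 1/7 - 1/11 + 1/13 + 1/17 - \<dots>\<close>.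
  This is Leibniz's series \<open>1 - 1/3 + 1/5 - \<dots> = \<pi>/4\<close> with the terms over odd multiples of 3
  removed. These terms are \<open>-1/3\<close> of Leibniz's series again, so that the sum
  is \<open>\<pi>/4 + \<pi>/12 = \<pi>/3\<close>.

  \<open>gcf_convergents_of_series\<close> reads off the convergents from the ratios of the denominators and
  the terms of the series; \<open>leibniz_without_multiples_of_3\<close> evaluates the series.
\<close>

text \<open>
  Euler's correspondence, with \<open>r\<close> the ratios \<open>B\<^sub>n / B\<^sub>n\<^sub>-\<^sub>1\<close>. The assumption on \<open>a\<close> says that
  \<open>r (Suc n) * r n = b (Suc n) * r n + a (Suc n)\<close>, i.e. that the product of the \<open>r k\<close> satisfies the
  recurrence of the denominators. The assumption on \<open>d\<close> is what remains of
  the recurrence of the numerators \<open>B\<^sub>n (b\<^sub>0 + d\<^sub>1 + \<dots> + d\<^sub>n)\<close>, taken at \<open>Suc n\<close>, after dividing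
  by \<open>B\<^sub>n\<close> and cancelling the sum up to \<open>d\<^sub>n\<^sub>-\<^sub>1\<close>.
\<close>

lemma gcf_convergents_of_series:
  fixes a b r d :: "nat \<Rightarrow> real"
  assumes "b 1 = r 1" "a 1 = r 1 * d 1"
    and a: "\<And>n. n \<ge> 1 \<Longrightarrow> a (Suc n) = (r (Suc n) - b (Suc n)) * r n"
    and d: "\<And>n. n \<ge> 1 \<Longrightarrow> (r (Suc n) - b (Suc n)) * d n = - (r (Suc n) * d (Suc n))"
  shows "gcf_den a b n = (\<Prod>k=1..n. r k)"
    and "gcf_num a b n = (\<Prod>k=1..n. r k) * (b 0 + (\<Sum>k=1..n. d k))"
proof -
  have "gcf_den a b n = (\<Prod>k=1..n. r k) \<and>
        gcf_num a b n = (\<Prod>k=1..n. r k) * (b 0 + (\<Sum>k=1..n. d k))"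
  proof (induction n rule: induct_nat_012)
    case 0
    show ?case by simp
  next
    case 1
    show ?case using assms(1,2) by (simp add: algebra_simps)
  next
    case (ge2 n)
    define m P S where "m = Suc (Suc n)" and "P = (\<Prod>k=1..n. r k)" and "S = b 0 + (\<Sum>k=1..n. d k)"
    have am: "a m = (r m - b m) * r (Suc n)"
      and dm: "(r m - b m) * d (Suc n) = - (r m * d m)"
      using a[of "Suc n"] d[of "Suc n"] by (simp_all add: m_def)
    have "gcf_den a b m = b m * (P * r (Suc n)) + a m * P"
      using ge2 by (simp add: m_def P_def)
    also have "\<dots> = P * r (Suc n) * r m"
      unfolding am by (simp add: algebra_simps)
    finally have den: "gcf_den a b m = P * r (Suc n) * r m" .
    have "gcf_num a b m = b m * (P * r (Suc n) * (S + d (Suc n))) + a m * (P * S)"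
      using ge2 by (simp add: m_def P_def S_def add.assoc)
    also have "\<dots> = P * r (Suc n) * (r m * (S + d (Suc n)) - (r m - b m) * d (Suc n))"
      unfolding am by (simp add: algebra_simps)
    also have "\<dots> = P * r (Suc n) * r m * (S + d (Suc n) + d m)"
      unfolding dm by (simp add: algebra_simps)
    finally have num: "gcf_num a b m = P * r (Suc n) * r m * (S + d (Suc n) + d m)" .
    show ?case
      using den num by (simp add: m_def P_def S_def add.assoc)
  qed
  then show "gcf_den a b n = (\<Prod>k=1..n. r k)"
    and "gcf_num a b n = (\<Prod>k=1..n. r k) * (b 0 + (\<Sum>k=1..n. d k))"
    by auto
qed

text \<open>
  In each block of three consecutive terms of Leibniz's series the middle one is a term over an
  odd multiple of 3. Adding a third of Leibniz's series therefore cancels precisely these terms,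
  already at the level of partial sums.
\<close>

lemma leibniz_without_multiples_of_3:
  "(\<lambda>n. \<Sum>k=1..n. (- 1) ^ (k - 1) * (1 / (6 * real k - 5) + 1 / (6 * real k - 1)))
     \<longlonglongrightarrow> pi / 3"
proof -
  define L :: "nat \<Rightarrow> real" where "L m = (\<Sum>j<m. (- 1) ^ j / (2 * real j + 1))" for m
  have "L \<longlonglongrightarrow> pi / 4"
  proof -
    have "summable (\<lambda>k. (- 1) ^ k * (1 / real (k * 2 + 1)) :: real)"
      using summable_arctan_series[of 1] by simp
    then have "(\<lambda>k. (- 1) ^ k * (1 / real (k * 2 + 1)) :: real) sums (pi / 4)"
      using pi_series by (simp add: sums_iff)
    then show ?thesis
      by (simp add: sums_def L_def[abs_def] mult.commute add.commute)
  qed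
  moreover have "strict_mono (\<lambda>n::nat. 3 * n)"
    by (simp add: strict_mono_def)
  ultimately have "(\<lambda>n. L (3 * n)) \<longlonglongrightarrow> pi / 4"
    using LIMSEQ_subseq_LIMSEQ[of L "pi / 4" "\<lambda>n. 3 * n"] by (simp add: o_def)
  then have "(\<lambda>n. L (3 * n) + L n / 3) \<longlonglongrightarrow> pi / 4 + pi / 4 / 3"
    using \<open>L \<longlonglongrightarrow> pi / 4\<close> by (intro tendsto_add tendsto_divide tendsto_const) auto
  moreover have "L (3 * n) + L n / 3 =
      (\<Sum>k=1..n. (- 1) ^ (k - 1) * (1 / (6 * real k - 5) + 1 / (6 * real k - 1)))" for n
  proof (induction n)
    case 0
    show ?case by (simp add: L_def)
  next
    case (Suc n)
    define s :: real where "s = (- 1) ^ n"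
    have s3: "(- 1) ^ (3 * n) = s"
      by (simp add: s_def power_mult)
    have block: "3 * Suc n = Suc (Suc (Suc (3 * n)))" by simp
    have "L (3 * Suc n) = L (3 * n) + s / (6 * real n + 1) - s / (6 * real n + 3)
        + s / (6 * real n + 5)"
      unfolding block L_def using s3 by (simp add: algebra_simps)
    moreover have "L (Suc n) / 3 = L n / 3 + s / (6 * real n + 3)"
    proof -
      have "s / (2 * real n + 1) / 3 = s / (6 * real n + 3)"
        by (simp add: algebra_simps)
      then show ?thesis by (simp add: L_def s_def add_divide_distrib)
    qed
    ultimately have "L (3 * Suc n) + L (Suc n) / 3 =
        L (3 * n) + L n / 3 + (s / (6 * real n + 1) + s / (6 * real n + 5))"
      by linarith
    also have "s / (6 * real n + 1) + s / (6 * real n + 5) =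
        s * (1 / (6 * real n + 1) + 1 / (6 * real n + 5))"
      by (simp add: distrib_left)
    finally have "L (3 * Suc n) + L (Suc n) / 3 =
        L (3 * n) + L n / 3 + s * (1 / (6 * real n + 1) + 1 / (6 * real n + 5))" .
    with Suc.IH show ?case by (simp add: s_def add.commute)
  qed
  ultimately show ?thesis by simp
qed

theorem corollary5:
  fixes a b :: "nat \<Rightarrow> real"
  assumes "b 0 = 0"
    and "a 1 = -6"
    and "b 1 = -5"
    and "\<And>n. n \<ge> 2 \<Longrightarrow> b n = 2 * (36 * real n ^ 2 - 72 * real n + 31)"
    and "\<And>n. n \<ge> 2 \<Longrightarrow> a n =
      (2 * real n - 1) * (2 * real n - 5) * (6 * real n - 11) ^ 2 * (6 * real n - 7) ^ 2"
  shows "a 2 = -75 \<and> b 2 = 62 \<and> a 3 = 29645 \<and> b 3 = 278 \<and> gcf_has_value a b (pi / 3)"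
proof -
  define r :: "nat \<Rightarrow> real"
    where "r k = (2 * real k - 3) * (6 * real k - 5) * (6 * real k - 1)" for k
  define d :: "nat \<Rightarrow> real"
    where "d k = (- 1) ^ (k - 1) * (1 / (6 * real k - 5) + 1 / (6 * real k - 1))" for k
  \<comment> \<open>The roots 3/2, 5/6 and 1/6 of the factors of \<open>r\<close> are not integers.\<close>
  have nz: "2 * real k - 3 \<noteq> 0" "6 * real k - 5 \<noteq> 0" "6 * real k - 1 \<noteq> 0" for k
  proof -
    have "2 * int k - 3 \<noteq> 0" "6 * int k - 5 \<noteq> 0" "6 * int k - 1 \<noteq> 0" by presburger+
    then have "real_of_int (2 * int k - 3) \<noteq> 0" "real_of_int (6 * int k - 5) \<noteq> 0"
      "real_of_int (6 * int k - 1) \<noteq> 0" by (simp_all only: of_int_eq_0_iff not_False_eq_True)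
    then show "2 * real k - 3 \<noteq> 0" "6 * real k - 5 \<noteq> 0" "6 * real k - 1 \<noteq> 0" by simp_all
  qed
  have r_nz: "r k \<noteq> 0" for k
    using nz[of k] by (simp add: r_def)
  have rb: "r (Suc n) - b (Suc n) = (2 * real n + 1) * (6 * real n - 5) * (6 * real n - 1)"
    if "n \<ge> 1" for n
    using that assms(4)[of "Suc n"] by (simp add: r_def power2_eq_square algebra_simps)
  have a_eq: "a (Suc n) = (r (Suc n) - b (Suc n)) * r n" if "n \<ge> 1" for n
    unfolding rb[OF that] using that assms(5)[of "Suc n"]
    by (simp add: r_def power2_eq_square algebra_simps)
  have d_eq: "(r (Suc n) - b (Suc n)) * d n = - (r (Suc n) * d (Suc n))" if "n \<ge> 1" for n
  proof -
    obtain m where n: "n = Suc m" using \<open>n \<ge> 1\<close> by (cases n) auto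
    \<comment> \<open>The two factors by which \<open>d k\<close> is multiplied on either side are the denominators of its
        two fractions, which turns \<open>d k\<close> into \<open>\<plusminus>6 (2k - 1)\<close>; both sides are then
        \<open>\<plusminus>6 (2n + 1)(2n - 1)\<close>.\<close>
    have clear: "p * q * (1 / p + 1 / q) = p + q" if "p \<noteq> 0" "q \<noteq> 0" for p q :: real
      using that by (simp add: field_simps)
    have c: "(6 * real k - 5) * (6 * real k - 1) * (1 / (6 * real k - 5) + 1 / (6 * real k - 1))
        = 12 * real k - 6" for k
      unfolding clear[OF nz(2,3)[of k]] by simp
    have "(r (Suc n) - b (Suc n)) * d n = (2 * real n + 1) * ((- 1) ^ m * (12 * real n - 6))"
      unfolding rb[OF that] c[of n, symmetric] by (simp add: d_def n mult_ac)
    moreover have "r (Suc n) * d (Suc n) =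
        (2 * real (Suc n) - 3) * ((- 1) ^ n * (12 * real (Suc n) - 6))"
      unfolding c[of "Suc n", symmetric] r_def d_def by (simp only: diff_Suc_1 mult_ac)
    ultimately show ?thesis by (simp add: n algebra_simps)
  qed
  have "b 1 = r 1" "a 1 = r 1 * d 1"
    using assms(2,3) by (simp_all add: r_def d_def)
  then have den: "gcf_den a b n = (\<Prod>k=1..n. r k)"
    and num: "gcf_num a b n = (\<Prod>k=1..n. r k) * (b 0 + (\<Sum>k=1..n. d k))" for n
    using gcf_convergents_of_series[of b r a d] a_eq d_eq by blast+
  have den_nz: "gcf_den a b n \<noteq> 0" for n
    unfolding den using r_nz by simp
  have "gcf_num a b n / gcf_den a b n = (\<Sum>k=1..n. d k)" for n
    using den_nz[of n] assms(1) unfolding den num by simp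
  then have "gcf_has_value a b (pi / 3)"
    using den_nz leibniz_without_multiples_of_3 by (simp add: gcf_has_value_def d_def)
  then show ?thesis
    using assms(4)[of 2] assms(4)[of 3] assms(5)[of 2] assms(5)[of 3] by simp
qed

end
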